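(* For every integer $n \ge 1$, $|\mathfrak{D}^4_{2n}(1342)| = 2^{n-1}$.
   Context: A permutation $\pi$ of $[N]=\{1,\dots,N\}$ is written as $\pi(1)\pi(2)\cdots\pi(N)$. A Dumont permutation of the fourth kind (Dumont-4 permutation) of size $2n$ is a permutation $\pi$ of $[2n]$ in which all deficiencies are even values at even positions: for all $1\le i\le 2n$, if $\pi(i)<i$ then both $i$ and $\pi(i)$ are even. The set of these is $\mathfrak{D}^4_{2n}$. A permutation $\pi$ of $[N]$ contains a pattern $\tau\in S_k$ if there are indices $i_1<\dots<i_k$ such that for all $a,b$, $\pi(i_a)<\pi(i_b)$ if and only if $\tau(a)<\tau(b)$; otherwise $\pi$ avoids $\tau$. $\mathfrak{D}^4_{2n}(\tau)$ denotes the set of permutations in $\mathfrak{D}^4_{2n}$ avoiding $\tau$. *)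

theory Defs
  imports "HOL-Combinatorics.Permutations"
begin

text \<open>A permutation of \<open>[N]\<close> is a function \<open>p\<close> with \<open>p permutes {1..N}\<close>, i.e. a bijection of
  \<open>{1..N}\<close> extended by the identity; distinct permutations are thus distinct functions.\<close>

definition one_line :: "nat list \<Rightarrow> nat \<Rightarrow> nat" where
  "one_line xs i = (if i \<in> {1..length xs} then xs ! (i - 1) else i)"

definition dumont4 :: "nat \<Rightarrow> (nat \<Rightarrow> nat) set" where
  "dumont4 n = {p. p permutes {1..2 * n} \<and>
     (\<forall>i\<in>{1..2 * n}. p i < i \<longrightarrow> even i \<and> even (p i))}"

text \<open>The function \<open>f\<close> below lists the indices \<open>f 1 < \<dots> < f k\<close> of an occurrence of the pattern.\<close>

definition contains_pattern :: "nat \<Rightarrow> (nat \<Rightarrow> nat) \<Rightarrow> nat \<Rightarrow> (nat \<Rightarrow> nat) \<Rightarrow> bool" where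
  "contains_pattern N p k t \<longleftrightarrow>
     (\<exists>f. f ` {1..k} \<subseteq> {1..N} \<and> strict_mono_on {1..k} f \<and>
          (\<forall>a\<in>{1..k}. \<forall>b\<in>{1..k}. p (f a) < p (f b) \<longleftrightarrow> t a < t b))"

definition dumont4_avoiding :: "nat \<Rightarrow> nat \<Rightarrow> (nat \<Rightarrow> nat) \<Rightarrow> (nat \<Rightarrow> nat) set" where
  "dumont4_avoiding n k t = {p \<in> dumont4 n. \<not> contains_pattern (2 * n) p k t}"

lemma one_line_1342_permutes: "one_line [1, 3, 4, 2] permutes {1..4}"
proof (rule bij_imp_permutes)
  have "{1..4::nat} = {1, 2, 3, 4}" by auto
  then show "bij_betw (one_line [1, 3, 4, 2]) {1..4} {1..4}"
    by (auto simp: bij_betw_def inj_on_def one_line_def)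
qed (auto simp: one_line_def)

end

theory Submission
  imports Defs
begin

text \<open>
  In a Dumont-4 permutation the value \<open>1\<close> can only sit at position \<open>1\<close>, and there it
  completes every 231 among the other entries to a 1342. So avoiding 1342 means that the remaining
  entries avoid 231.
  Two observations turn this into a very rigid shape.

  First, odd points are fixed. If an odd \<open>i\<close> is not fixed, then \<open>p i > i\<close>, and the value \<open>i\<close> sits
  to the left of position \<open>i\<close>. These two entries form an ascent from \<open>i\<close> to \<open>p i\<close>, so
  231-avoidance keeps all entries to the right of position \<open>i\<close> above \<open>i\<close>. Hence \<open>p\<close> preserves
  \<open>{i<..2n}\<close> and also its complement, which contradicts \<open>p i > i\<close>. Second, the now fixed
  odd points \<open>p i + 1\<close> and \<open>i - 1\<close> would create a 231 together with a deficiency at \<open>i\<close> unless they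
  coincide; so every deficiency satisfies \<open>p i = i - 2\<close>.

  Conversely, these two properties imply the avoidance (\<open>even_drop_avoids_1342\<close>), because every even
  position \<open>i\<close> with \<open>p i \<ge> i\<close> splits the permutation into an initial and a final part.
  So these two properties describe the class exactly (\<open>dumont4_avoiding_1342_eq\<close>).

  The permutations of this shape are easily counted. The position \<open>2n + 2\<close> carries \<open>2n + 2\<close> or \<open>2n\<close>,
  and exchanging these two values leads from either case to the other (\<open>even_drop_perms_Suc\<close>).
  So each step from \<open>n\<close> to \<open>n + 1\<close> doubles the number, beginning with the identity for \<open>n = 1\<close>.
\<close>

section \<open>Occurrences of 1342\<close>

lemma contains_1342_iff:
  "contains_pattern N p 4 (one_line [1, 3, 4, 2]) \<longleftrightarrow>
     (\<exists>a b c d. 1 \<le> a \<and> a < b \<and> b < c \<and> c < d \<and> d \<le> N \<and> p a < p d \<and> p d < p b \<and> p b < p c)"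
  (is "?L \<longleftrightarrow> ?R")
proof
  have I: "{1..4} = {1, 2, 3, 4::nat}" by auto
  {
    assume ?L
    then obtain f where f: "f ` {1..4} \<subseteq> {1..N}" "strict_mono_on {1..4} f"
      and o: "\<forall>a\<in>{1..4}. \<forall>b\<in>{1..4}.
        p (f a) < p (f b) \<longleftrightarrow> one_line [1, 3, 4, 2] a < one_line [1, 3, 4, 2] b"
      unfolding contains_pattern_def by blast
    have "f 1 < f 2" "f 2 < f 3" "f 3 < f 4"
      using f(2) by (auto simp: strict_mono_on_def)
    moreover have "1 \<le> f 1" "f 4 \<le> N"
      using f(1) unfolding I by auto
    moreover have "p (f 1) < p (f 4)" "p (f 4) < p (f 2)" "p (f 2) < p (f 3)"
      using o by (auto simp: one_line_def)
    ultimately show ?R by blast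
  }
  {
    assume ?R
    then obtain a b c d where h: "1 \<le> a" "a < b" "b < c" "c < d" "d \<le> N"
      "p a < p d" "p d < p b" "p b < p c" by blast
    define f where "f = (\<lambda>i::nat. if i = 1 then a else if i = 2 then b else if i = 3 then c else d)"
    have "f ` {1..4} \<subseteq> {1..N}" unfolding I f_def using h by auto
    moreover have "strict_mono_on {1..4} f"
      unfolding I using h by (auto simp: strict_mono_on_def f_def)
    moreover have "\<forall>a\<in>{1..4}. \<forall>b\<in>{1..4}.
        p (f a) < p (f b) \<longleftrightarrow> one_line [1, 3, 4, 2] a < one_line [1, 3, 4, 2] b"
      unfolding I using h by (simp add: f_def one_line_def)
    ultimately show ?L unfolding contains_pattern_def by blast
  }
qed

section \<open>The shape of the avoiding permutations\<close>

text \<open>An injection of the finite set \<open>{i..N}\<close> into itself fills it, so no room is left there for values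
  from earlier positions. Both directions of the characterisation below reduce to finding such a
  cut position.\<close>

lemma permutes_invariant_final_part:
  fixes p :: "nat \<Rightarrow> nat"
  assumes "p permutes {1..N}"
    and final: "\<And>k. i \<le> k \<Longrightarrow> k \<le> N \<Longrightarrow> i \<le> p k"
    and "k < i"
  shows "p k < i"
proof (rule ccontr)
  assume "\<not> p k < i"
  then have "i \<le> p k" by simp
  have inj: "inj p" using assms(1) by (rule permutes_inj)
  have above: "p m = m" if "N < m" for m
    using assms(1) that by (auto simp: permutes_def)
  have "p ` {i..N} \<subseteq> {i..N}"
  proof
    fix y assume "y \<in> p ` {i..N}"
    then obtain m where m: "y = p m" "i \<le> m" "m \<le> N" by auto
    have "p m \<le> N"
      using above[of "p m"] injD[OF inj, of "p m" m] m(3) by (metis not_le)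
    then show "y \<in> {i..N}" using m final by auto
  qed
  then have surj: "p ` {i..N} = {i..N}"
    by (intro endo_inj_surj) (auto intro: inj_on_subset[OF inj])
  show False
  proof (cases "p k \<le> N")
    case True
    then have "p k \<in> p ` {i..N}" using \<open>i \<le> p k\<close> surj by simp
    then obtain m where "p k = p m" "i \<le> m" by auto
    then show False using injD[OF inj, of k m] \<open>k < i\<close> by simp
  next
    case False
    then have "p k = k" using above[of "p k"] injD[OF inj, of "p k" k] by simp
    then show False using \<open>i \<le> p k\<close> \<open>k < i\<close> by simp
  qed
qed

text \<open>Restricted to the even points and halved, these are the permutations \<open>s\<close> of \<open>[n]\<close> with
  \<open>s j \<ge> j - 1\<close>. Both conditions range over all \<open>i\<close>, since a permutation of \<open>{1..2 * n}\<close> fixes the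
  points outside that interval anyway.\<close>

definition even_drop_perms :: "nat \<Rightarrow> (nat \<Rightarrow> nat) set" where
  "even_drop_perms n = {p. p permutes {1..2 * n} \<and>
     (\<forall>i. odd i \<longrightarrow> p i = i) \<and> (\<forall>i. even i \<longrightarrow> i \<le> p i \<or> p i + 2 = i)}"

lemma even_drop_permsD:
  assumes "p \<in> even_drop_perms n"
  shows "p permutes {1..2 * n}" "odd i \<Longrightarrow> p i = i" "even i \<Longrightarrow> i \<le> p i \<or> p i + 2 = i"
  using assms unfolding even_drop_perms_def by blast+

lemma even_drop_split:
  assumes "p \<in> even_drop_perms n" "even i" "i \<le> p i" "k < i"
  shows "p k < i"
proof (rule permutes_invariant_final_part[where p = p and k = k and i = i and N = "2 * n"])
  show "p permutes {1..2 * n}" using assms(1) by (simp add: even_drop_perms_def)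
next
  fix m assume "i \<le> m"
  consider "m = i" | "odd m" | "even m" "i + 2 \<le> m"
    using \<open>i \<le> m\<close> \<open>even i\<close> by (cases "m = i"; cases "m = i + 1") auto
  then show "i \<le> p m"
  proof cases
    case 3
    then show ?thesis using even_drop_permsD(3)[OF assms(1), of m] by linarith
  qed (use assms even_drop_permsD(2)[OF assms(1)] \<open>i \<le> m\<close> in auto)
qed (use assms in auto)

text \<open>Suppose that a 231 occurs at positions \<open>b < c < d\<close>. If each of \<open>c\<close> and \<open>d\<close> were odd or carried a
  deficiency, then \<open>p c \<le> c\<close> and \<open>c - 1 \<le> d - 2 \<le> p d\<close>, which leaves no value for \<open>p b\<close> strictly
  between. So one of them is an even position without a deficiency, and the permutation splits
  there, which makes \<open>p b\<close> too small.\<close>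

lemma even_drop_avoids_231:
  assumes "p \<in> even_drop_perms n" "b < c" "c < d" "p d < p b" "p b < p c"
  shows False
proof -
  have odd_fixed: "p i = i" if "odd i" for i
    using even_drop_permsD(2)[OF assms(1)] that .
  have split: "p k < i" if "even i" "i \<le> p i" "k < i" for i k
    using even_drop_split[OF assms(1)] that by blast
  consider "even d" "d \<le> p d" | "d \<le> p d + 2" "odd d \<longrightarrow> p d = d"
    using even_drop_permsD(3)[OF assms(1), of d] odd_fixed[of d] by (cases "even d") auto
  then show False
  proof cases
    case 1
    then show False using split[of d b] assms by simp
  next
    case 2
    have "c \<le> p c" using 2 assms(2-5) by linarith
    show False
    proof (cases "even c")
      case True
      then show False using split[of c b] \<open>c \<le> p c\<close> 2 assms by linarith
    next
      case False
      then show False using odd_fixed[of c] 2 assms by linarith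
    qed
  qed
qed

lemma even_drop_avoids_1342:
  assumes "p \<in> even_drop_perms n"
  shows "\<not> contains_pattern N p 4 (one_line [1, 3, 4, 2])"
  unfolding contains_1342_iff using even_drop_avoids_231[OF assms] by blast

lemma dumont4_fixes_one:
  assumes "p \<in> dumont4 n"
  shows "p 1 = 1"
proof (rule ccontr)
  assume "p 1 \<noteq> 1"
  have p: "p permutes {1..2 * n}" using assms by (simp add: dumont4_def)
  obtain j where j: "p j = 1" using permutes_surj[OF p] by (metis surjD)
  then have "j \<noteq> 1" using \<open>p 1 \<noteq> 1\<close> by auto
  then have "j \<in> {1..2 * n}" using p j by (metis permutes_not_in)
  moreover have "p j < j" using calculation j \<open>j \<noteq> 1\<close> by simp
  ultimately have "even (p j)" using assms unfolding dumont4_def by blast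
  then show False using j by simp
qed

text \<open>The fixed point \<open>1\<close> would complete a 231 to a 1342.\<close>

lemma dumont4_avoiding_231:
  assumes "p \<in> dumont4_avoiding n 4 (one_line [1, 3, 4, 2])"
    and "1 < b" "b < c" "c < d" "d \<le> 2 * n" "p b < p c"
  shows "p b \<le> p d"
proof (rule ccontr)
  assume "\<not> p b \<le> p d"
  have D: "p \<in> dumont4 n" and av: "\<not> contains_pattern (2 * n) p 4 (one_line [1, 3, 4, 2])"
    using assms(1) by (auto simp: dumont4_avoiding_def)
  have p: "p permutes {1..2 * n}" using D by (simp add: dumont4_def)
  have "p d \<in> {1..2 * n}" using p assms by (subst permutes_in_image) auto
  moreover have "p d \<noteq> 1"
    using dumont4_fixes_one[OF D] injD[OF permutes_inj[OF p], of d 1] assms by auto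
  ultimately have "p 1 < p d" using dumont4_fixes_one[OF D] by auto
  then show False
    using av \<open>\<not> p b \<le> p d\<close> assms unfolding contains_1342_iff by (metis le_refl not_le)
qed

lemma dumont4_avoiding_odd_fixed:
  assumes av: "p \<in> dumont4_avoiding n 4 (one_line [1, 3, 4, 2])" and "odd i"
  shows "p i = i"
proof (rule ccontr)
  assume "p i \<noteq> i"
  have D: "p \<in> dumont4 n" using av by (simp add: dumont4_avoiding_def)
  have p: "p permutes {1..2 * n}" using D by (simp add: dumont4_def)
  have inj: "inj p" using p by (rule permutes_inj)
  have iN: "i \<in> {1..2 * n}" using p \<open>p i \<noteq> i\<close> by (metis permutes_not_in)
  have "i \<le> p i" using D iN \<open>odd i\<close> unfolding dumont4_def by (simp add: Ball_def) (meson not_le)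
  then have up: "i < p i" using \<open>p i \<noteq> i\<close> by simp
  obtain j where j: "p j = i" using permutes_surj[OF p] by (metis surjD)
  have "j \<noteq> i" using j \<open>p i \<noteq> i\<close> by auto
  have jN: "j \<in> {1..2 * n}" using p j \<open>j \<noteq> i\<close> by (metis permutes_not_in)
  have "j \<le> i" using D jN j \<open>odd i\<close> unfolding dumont4_def by (simp add: Ball_def) (metis not_le)
  have "j \<noteq> 1" using dumont4_fixes_one[OF D] j \<open>j \<noteq> i\<close> by auto
  \<comment> \<open>The ascent \<open>i < p i\<close> at positions \<open>j < i\<close> keeps all later entries above \<open>i\<close>.\<close>
  have "p i < Suc i"
  proof (rule permutes_invariant_final_part[OF p])
    fix k assume k: "Suc i \<le> k" "k \<le> 2 * n"
    have "p j \<le> p k"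
      by (rule dumont4_avoiding_231[OF av, of j i k])
        (use jN \<open>j \<noteq> 1\<close> \<open>j \<le> i\<close> \<open>j \<noteq> i\<close> k j up in auto)
    moreover have "p k \<noteq> i" using injD[OF inj, of k j] j k \<open>j \<le> i\<close> by auto
    ultimately show "Suc i \<le> p k" using j by simp
  qed simp
  then show False using up by simp
qed

theorem dumont4_avoiding_1342_eq:
  "dumont4_avoiding n 4 (one_line [1, 3, 4, 2]) = even_drop_perms n"
proof
  show "even_drop_perms n \<subseteq> dumont4_avoiding n 4 (one_line [1, 3, 4, 2])"
  proof
    fix p assume p: "p \<in> even_drop_perms n"
    have "even i \<and> even (p i)" if "p i < i" for i
    proof -
      have "even i" using even_drop_permsD(2)[OF p, of i] that by auto
      then have "p i + 2 = i" using even_drop_permsD(3)[OF p, of i] that by simp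
      then show ?thesis using \<open>even i\<close> by (metis even_add even_numeral)
    qed
    then show "p \<in> dumont4_avoiding n 4 (one_line [1, 3, 4, 2])"
      using even_drop_permsD(1)[OF p] even_drop_avoids_1342[OF p]
      by (simp add: dumont4_avoiding_def dumont4_def)
  qed
  show "dumont4_avoiding n 4 (one_line [1, 3, 4, 2]) \<subseteq> even_drop_perms n"
  proof
    fix p assume av: "p \<in> dumont4_avoiding n 4 (one_line [1, 3, 4, 2])"
    have D: "p \<in> dumont4 n" using av by (simp add: dumont4_avoiding_def)
    have p: "p permutes {1..2 * n}" using D by (simp add: dumont4_def)
    have odd_fixed: "p i = i" if "odd i" for i
      using dumont4_avoiding_odd_fixed[OF av that] .
    have "p i + 2 = i" if "p i < i" for i
    proof (rule ccontr)
      assume "p i + 2 \<noteq> i"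
      have iN: "i \<in> {1..2 * n}" using p that by (metis permutes_not_in less_irrefl)
      have ev: "even i" "even (p i)" using D iN that unfolding dumont4_def by blast+
      have "1 \<le> p i" using permutes_in_image[OF p] iN by auto
      \<comment> \<open>Then \<open>p i + 1 < i - 1\<close> are two distinct fixed points, and they form a 231 with \<open>p i\<close>.\<close>
      have "p i + 2 < i"
        using that \<open>p i + 2 \<noteq> i\<close> ev by (metis add_2_eq_Suc' even_Suc less_antisym not_less_eq)
      moreover have "p (p i + 1) = p i + 1" "p (i - 1) = i - 1"
        using ev that by (auto intro!: odd_fixed)
      moreover have "p (p i + 1) \<le> p i"
        by (rule dumont4_avoiding_231[OF av, of "p i + 1" "i - 1" i])
          (use calculation iN \<open>1 \<le> p i\<close> in auto)
      ultimately show False by simp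
    qed
    then have "i \<le> p i \<or> p i + 2 = i" for i by (meson not_le)
    then show "p \<in> even_drop_perms n" using p odd_fixed by (simp add: even_drop_perms_def)
  qed
qed

section \<open>Counting\<close>

lemma even_drop_perms_1: "even_drop_perms 1 = {id}"
proof
  show "even_drop_perms 1 \<subseteq> {id}"
  proof
    fix p assume p: "p \<in> even_drop_perms 1"
    have P: "p permutes {1..2}" using p by (simp add: even_drop_perms_def)
    have "p 1 = 1" using p by (simp add: even_drop_perms_def)
    moreover have "p 2 = 2"
      using permutes_in_image[OF P, of 2] injD[OF permutes_inj[OF P], of 2 1] \<open>p 1 = 1\<close>
      by (cases "p 2 = 1") auto
    moreover have "p x = x" if "x \<noteq> 1" "x \<noteq> 2" for x
      using permutes_not_in[OF P, of x] that by auto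
    ultimately have "p x = x" for x by metis
    then show "p \<in> {id}" by (simp add: fun_eq_iff)
  qed
qed (simp add: even_drop_perms_def permutes_id)

abbreviation swap_top :: "nat \<Rightarrow> (nat \<Rightarrow> nat) \<Rightarrow> nat \<Rightarrow> nat" where
  "swap_top n p \<equiv> transpose (2 * n) (2 * n + 2) \<circ> p"

lemma even_drop_perms_mono: "even_drop_perms n \<subseteq> even_drop_perms (Suc n)"
proof -
  have "p permutes {1..2 * Suc n}" if "p permutes {1..2 * n}" for p
    using that by (rule permutes_subset) auto
  then show ?thesis unfolding even_drop_perms_def by blast
qed

lemma even_drop_perms_top:
  assumes "p \<in> even_drop_perms n" "2 * n < i"
  shows "p i = i"
  using assms by (auto simp: even_drop_perms_def permutes_def)

lemma even_drop_perms_restrict: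
  assumes "p \<in> even_drop_perms (Suc n)" "p (2 * n + 2) = 2 * n + 2"
  shows "p \<in> even_drop_perms n"
proof -
  have "p permutes {1..2 * Suc n}" using assms by (simp add: even_drop_perms_def)
  moreover have "p x = x" if "x \<in> {1..2 * Suc n} - {1..2 * n}" for x
  proof -
    have "x = 2 * n + 1 \<or> x = 2 * n + 2" using that by auto
    then show ?thesis using assms by (auto simp: even_drop_perms_def)
  qed
  ultimately have "p permutes {1..2 * n}" by (rule permutes_superset)
  then show ?thesis using assms by (simp add: even_drop_perms_def)
qed

text \<open>Raising the value \<open>2n\<close> to \<open>2n + 2\<close> is harmless. The value \<open>2n + 2\<close> sits at a position of at most \<open>2n\<close> or at its own, so lowering it to \<open>2n\<close> does
  not create a deficiency except at position \<open>2n + 2\<close>, where the drop is the admissible one.\<close>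

lemma swap_top_mem:
  assumes "p \<in> even_drop_perms (Suc n)" "n \<ge> 1"
  shows "swap_top n p \<in> even_drop_perms (Suc n)"
proof -
  have P: "p permutes {1..2 * Suc n}" using assms by (simp add: even_drop_perms_def)
  have T: "transpose (2 * n) (2 * n + 2) permutes {1..2 * Suc n}"
    using assms(2) by (intro permutes_swap_id) auto
  have odd_fixed: "swap_top n p i = i" if "odd i" for i
  proof -
    have "p i = i" using that assms by (simp add: even_drop_perms_def)
    moreover have "i \<noteq> 2 * n" "i \<noteq> 2 * n + 2" using that by auto
    ultimately show ?thesis by simp
  qed
  have drop: "i \<le> swap_top n p i \<or> swap_top n p i + 2 = i" if "even i" for i
  proof -
    have pi: "i \<le> p i \<or> p i + 2 = i" using that assms by (simp add: even_drop_perms_def)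
    consider "p i = 2 * n" | "p i = 2 * n + 2" | "p i \<noteq> 2 * n" "p i \<noteq> 2 * n + 2" by blast
    then show ?thesis
    proof cases
      case 1
      then show ?thesis using pi by auto
    next
      case 2
      then have "i \<le> 2 * n + 2" using permutes_in_image[OF P, of i] by auto
      then have "i \<le> 2 * n \<or> i = 2 * n + 2" using \<open>even i\<close> by (auto simp: le_Suc_eq)
      then show ?thesis using 2 by auto
    next
      case 3
      then show ?thesis using pi by simp
    qed
  qed
  show ?thesis
    using permutes_compose[OF P T] odd_fixed drop by (simp add: even_drop_perms_def)
qed

lemma swap_top_swap_top: "swap_top n (swap_top n p) = p"
  by (simp add: fun_eq_iff)

lemma even_drop_perms_Suc:
  assumes "n \<ge> 1"
  shows "even_drop_perms (Suc n) = even_drop_perms n \<union> swap_top n ` even_drop_perms n"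
proof
  show "even_drop_perms n \<union> swap_top n ` even_drop_perms n \<subseteq> even_drop_perms (Suc n)"
    using even_drop_perms_mono swap_top_mem[OF _ assms] by blast
  show "even_drop_perms (Suc n) \<subseteq> even_drop_perms n \<union> swap_top n ` even_drop_perms n"
  proof
    fix p assume p: "p \<in> even_drop_perms (Suc n)"
    have P: "p permutes {1..2 * Suc n}" using p by (simp add: even_drop_perms_def)
    have "2 * n + 2 \<le> p (2 * n + 2) \<or> p (2 * n + 2) + 2 = 2 * n + 2"
      by (rule even_drop_permsD(3)[OF p]) simp
    moreover have "p (2 * n + 2) \<le> 2 * n + 2" using permutes_in_image[OF P, of "2 * n + 2"] by simp
    ultimately consider "p (2 * n + 2) = 2 * n + 2" | "p (2 * n + 2) = 2 * n" by linarith
    then show "p \<in> even_drop_perms n \<union> swap_top n ` even_drop_perms n"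
    proof cases
      case 1
      then show ?thesis using even_drop_perms_restrict[OF p] by simp
    next
      case 2
      then have "swap_top n p \<in> even_drop_perms n"
        using even_drop_perms_restrict[OF swap_top_mem[OF p assms]] by simp
      then show ?thesis using swap_top_swap_top[of n p] by (metis UnI2 imageI)
    qed
  qed
qed

lemma card_even_drop_perms_Suc:
  assumes "n \<ge> 1"
  shows "card (even_drop_perms (Suc n)) = 2 * card (even_drop_perms n)"
proof -
  have fin: "finite (even_drop_perms n)"
    by (rule finite_subset[OF _ finite_permutations[of "{1..2 * n}"]])
      (auto simp: even_drop_perms_def)
  have "inj_on (swap_top n) (even_drop_perms n)"
    by (rule inj_on_inverseI) (rule swap_top_swap_top)
  then have "card (swap_top n ` even_drop_perms n) = card (even_drop_perms n)"
    by (rule card_image)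
  moreover have "even_drop_perms n \<inter> swap_top n ` even_drop_perms n = {}"
  proof -
    have "swap_top n p (2 * n + 2) \<noteq> 2 * n + 2" if "p \<in> even_drop_perms n" for p
      using even_drop_perms_top[OF that, of "2 * n + 2"] by simp
    then show ?thesis using even_drop_perms_top[of _ n "2 * n + 2"] by fastforce
  qed
  ultimately show ?thesis
    unfolding even_drop_perms_Suc[OF assms] using fin by (simp add: card_Un_disjoint)
qed

theorem theorem3p2:
  fixes n :: nat
  assumes "n \<ge> 1"
  shows "card (dumont4_avoiding n 4 (one_line [1, 3, 4, 2])) = 2 ^ (n - 1)"
proof -
  have "card (even_drop_perms n) = 2 ^ (n - 1)"
    using assms
  proof (induction n rule: dec_induct)
    case base
    then show ?case by (simp only: even_drop_perms_1) simp
  next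
    case (step n)
    then show ?case using card_even_drop_perms_Suc[of n] by (cases n) auto
  qed
  then show ?thesis by (simp only: dumont4_avoiding_1342_eq)
qed

end
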